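(* Let $X$ be a metric space and $r\colon X\to X$ an $N$-to-$1$ map with branches $\tau_k\colon X\to X$, $k\in\{1,\dots,N\}$, i.e., $r(\tau_k(x))=x$ for $x\in X$, and the sets $\tau_k(X)$ are disjoint and cover $X$. Let $W,h\ge0$ be two functions on $X$ such that $$\sum_{k=1}^NW(\tau_k(x))h(\tau_k(x))=h(x),\qquad x\in X.$$ Then for every $x\in X$ there exists a positive Radon measure $P_x$ on $\Omega=\prod_{\mathbb{N}}\{1,\dots,N\}$ such that, if $f$ is a bounded measurable function on $\Omega$ which depends only on the first $n$ coordinates $\omega_1,\dots,\omega_n$, then $$\int_\Omega f(\omega)\,dP_x(\omega)=\sum_{\omega_1,\dots,\omega_n}W^{(n)}(\tau_{\omega_n}\tau_{\omega_{n-1}}\cdots\tau_{\omega_1}(x))\,h(\tau_{\omega_n}\tau_{\omega_{n-1}}\cdots\tau_{\omega_1}(x))\,f(\omega_1,\dots,\omega_n).$$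
   Context: $\Omega=\prod_{\mathbb{N}}\{1,\dots,N\}$ carries the product topology and the Borel structure generated by cylinder sets. $W^{(n)}(x):=W(x)W(r(x))\cdots W(r^{n-1}(x))$ for $x\in X$. The sum is over all $(\omega_1,\dots,\omega_n)\in\{1,\dots,N\}^n$. *)

theory Defs
  imports "HOL-Analysis.Analysis"
begin

(* Coordinates are indexed from 0: the coordinate called omega_(i+1) in the usual notation is
   \<omega> i.  Finite words (omega_1, ..., omega_n) are elements of PiE {..<n} (\<lambda>_. {1..N}). *)

definition seq_space :: "nat \<Rightarrow> (nat \<Rightarrow> nat) set" where
  "seq_space N = (\<Pi>\<^sub>E i\<in>UNIV. {1..N})"

definition seq_topology :: "nat \<Rightarrow> (nat \<Rightarrow> nat) topology" where
  "seq_topology N = product_topology (\<lambda>_. discrete_topology {1..N}) UNIV"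

(* Only the sigma-algebra of this product matters: it is generated by the cylinder sets. *)
definition seq_algebra :: "nat \<Rightarrow> (nat \<Rightarrow> nat) measure" where
  "seq_algebra N = (\<Pi>\<^sub>M i\<in>UNIV. count_space {1..N})"

definition borel_algebra :: "'a topology \<Rightarrow> 'a measure" where
  "borel_algebra T = sigma (topspace T) {U. openin T U}"

(* Intended for locally compact Hausdorff T, where compact sets are closed and hence Borel. *)
definition radon_measure :: "'a topology \<Rightarrow> 'a measure \<Rightarrow> bool" where
  "radon_measure T M \<longleftrightarrow>
     sets M = sets (borel_algebra T) \<and>
     (\<forall>K. compactin T K \<longrightarrow> emeasure M K < \<infinity>) \<and>
     (\<forall>A\<in>sets M. emeasure M A = (INF U\<in>{U. openin T U \<and> A \<subseteq> U}. emeasure M U)) \<and>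
     (\<forall>U. openin T U \<longrightarrow> emeasure M U = (SUP K\<in>{K. compactin T K \<and> K \<subseteq> U}. emeasure M K))"

(* f depends only on the first n coordinates, and g is the resulting function of n-letter words:
   g (omega_1, ..., omega_n) is what is usually still written f (omega_1, ..., omega_n).
   For N > 0 every word extends to a sequence, so f determines g on all words. *)
definition depends_on_first ::
    "nat \<Rightarrow> nat \<Rightarrow> ((nat \<Rightarrow> nat) \<Rightarrow> 'b) \<Rightarrow> ((nat \<Rightarrow> nat) \<Rightarrow> 'b) \<Rightarrow> bool" where
  "depends_on_first N n f g \<longleftrightarrow> (\<forall>\<omega>\<in>seq_space N. f \<omega> = g (restrict \<omega> {..<n}))"

definition cocycle :: "('a \<Rightarrow> real) \<Rightarrow> ('a \<Rightarrow> 'a) \<Rightarrow> nat \<Rightarrow> 'a \<Rightarrow> real" where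
  "cocycle W r n x = (\<Prod>i<n. W ((r ^^ i) x))"

(* branch_word \<tau> w n x = \<tau> (w (n - 1)) (... (\<tau> (w 0) x)) *)
primrec branch_word :: "(nat \<Rightarrow> 'a \<Rightarrow> 'a) \<Rightarrow> (nat \<Rightarrow> nat) \<Rightarrow> nat \<Rightarrow> 'a \<Rightarrow> 'a" where
  "branch_word \<tau> w 0 x = x"
| "branch_word \<tau> w (Suc n) x = \<tau> (w n) (branch_word \<tau> w n x)"

end

theory Submission
  imports Defs "HOL-Probability.Projective_Family"
begin

text \<open>Write \<open>q n w\<close> for the product of the cocycle and \<open>h\<close> at the end point of the word \<open>w\<close> of
  length \<open>n\<close>. The harmonicity of \<open>h\<close> says exactly that the masses \<open>q n w\<close> are consistent: summing over
  the last letter of a word of length \<open>n + 1\<close> gives the mass of its first \<open>n\<close> letters. After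
  normalisation they are the marginals of a process with transition weights \<open>q (n + 1) / q n\<close>, which
  the Ionescu-Tulcea theorem extends to sequences. The sequence space is compact and embeds into
  the Polish space \<open>nat \<Rightarrow> real\<close>, where finite Borel measures are regular.\<close>

section \<open>Borel sets of a topology, and regularity on compact spaces\<close>

lemma space_borel_algebra [simp]: "space (borel_algebra T) = topspace T"
  unfolding borel_algebra_def by (rule space_measure_of) (auto dest: openin_subset)

lemma sets_borel_algebra: "sets (borel_algebra T) = sigma_sets (topspace T) {U. openin T U}"
  unfolding borel_algebra_def by (rule sets_measure_of) (auto dest: openin_subset)

lemma borel_algebra_openin: "openin T U \<Longrightarrow> U \<in> sets (borel_algebra T)"
  by (simp add: sets_borel_algebra)

lemma sets_borel_algebra_subset:
  assumes "space M = topspace T" and "\<And>U. openin T U \<Longrightarrow> U \<in> sets M"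
  shows "sets (borel_algebra T) \<subseteq> sets M"
  using assms sets.sigma_sets_subset[of "{U. openin T U}" M] by (auto simp: sets_borel_algebra)

lemma measurable_borel_algebra_continuous_map:
  fixes e :: "'a \<Rightarrow> 'b::topological_space"
  assumes "continuous_map T euclidean e"
  shows "e \<in> borel_measurable (borel_algebra T)"
proof (rule borel_measurableI)
  fix V :: "'b set"
  assume "open V"
  then have "openin T {x \<in> topspace T. e x \<in> V}"
    using assms by (intro openin_continuous_map_preimage) auto
  moreover have "e -` V \<inter> space (borel_algebra T) = {x \<in> topspace T. e x \<in> V}"
    by auto
  ultimately show "e -` V \<inter> space (borel_algebra T) \<in> sets (borel_algebra T)"
    by (simp add: borel_algebra_openin)
qed

text \<open>Closed subsets of \<open>T\<close> are compact, so their images under \<open>e\<close>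
  are compact, hence closed in the Hausdorff target. By injectivity every open set of
  \<open>T\<close> is then the preimage of an open set; continuity gives the other
  inclusion.\<close>

lemma borel_algebra_eq_vimage_algebra:
  fixes e :: "'a \<Rightarrow> 'b::t2_space"
  assumes "compact_space T" and e: "continuous_map T euclidean e" and inj: "inj_on e (topspace T)"
  shows "sets (borel_algebra T) = sets (vimage_algebra (topspace T) e borel)"
proof
  show "sets (borel_algebra T) \<subseteq> sets (vimage_algebra (topspace T) e borel)"
  proof (rule sets_borel_algebra_subset)
    fix U
    assume U: "openin T U"
    let ?C = "e ` (topspace T - U)"
    have "compactin T (topspace T - U)"
      using U \<open>compact_space T\<close> by (intro closedin_compact_space) auto
    then have "closed ?C"
      using image_compactin[OF _ e] by (simp add: compact_imp_closed)
    then have "- ?C \<in> sets borel"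
      by simp
    moreover have "U = e -` (- ?C) \<inter> topspace T"
      using inj openin_subset[OF U] by (auto simp: inj_on_def)
    ultimately show "U \<in> sets (vimage_algebra (topspace T) e borel)"
      using in_vimage_algebra by metis
  qed simp
next
  show "sets (vimage_algebra (topspace T) e borel) \<subseteq> sets (borel_algebra T)"
    using measurable_sets[OF measurable_borel_algebra_continuous_map[OF e]]
    by (auto simp: sets_vimage_algebra2)
qed

text \<open>An injective continuous map \<open>e\<close> into a complete metric space transports the regularity of
  finite Borel measures there back to \<open>T\<close>; preimages of compact sets are compact because \<open>T\<close> is.\<close>

lemma radon_measure_compact_space:
  fixes e :: "'a \<Rightarrow> 'b::{second_countable_topology, complete_space}"
  assumes T: "compact_space T" and e: "continuous_map T euclidean e"
    and inj: "inj_on e (topspace T)"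
    and M: "finite_measure M" "sets M = sets (borel_algebra T)"
  shows "radon_measure T M"
proof -
  interpret finite_measure M by fact
  have space: "space M = topspace T"
    using sets_eq_imp_space_eq[OF M(2)] by simp
  have e_meas [measurable]: "e \<in> borel_measurable M"
    using measurable_borel_algebra_continuous_map[OF e] measurable_cong_sets[OF M(2) refl] by blast
  let ?Q = "distr M borel e"
  let ?pre = "\<lambda>B. e -` B \<inter> topspace T"
  have Q: "emeasure ?Q B = emeasure M (?pre B)" if "B \<in> sets borel" for B
    using that by (simp add: emeasure_distr space)
  have "finite_measure ?Q"
    by (rule finite_measure_distr) (fact e_meas)
  then have Q_fin: "emeasure ?Q (space ?Q) \<noteq> \<infinity>"
    by (simp add: finite_measure.emeasure_finite)
  \<comment> \<open>Since the Borel sets of \<open>T\<close> are exactly the preimages of Borel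
    sets, \<open>?Q\<close> determines \<open>M\<close> on every measurable set.\<close>
  have pre_ex: "\<exists>B \<in> sets borel. A = ?pre B" if "A \<in> sets M" for A
    using that
    by (auto simp: M(2) borel_algebra_eq_vimage_algebra[OF T e inj] sets_vimage_algebra2)
  show ?thesis
    unfolding radon_measure_def
  proof (intro conjI allI ballI impI)
    show "sets M = sets (borel_algebra T)"
      by fact
    show "emeasure M K < \<infinity>" for K
      by (simp add: less_top[symmetric])
  next
    fix A
    assume "A \<in> sets M"
    then obtain B where B: "B \<in> sets borel" "A = ?pre B"
      using pre_ex by blast
    show "emeasure M A = (INF U\<in>{U. openin T U \<and> A \<subseteq> U}. emeasure M U)"
    proof (rule antisym)
      show "emeasure M A \<le> (INF U\<in>{U. openin T U \<and> A \<subseteq> U}. emeasure M U)"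
        by (rule INF_greatest) (auto intro!: emeasure_mono simp: M borel_algebra_openin)
      \<comment> \<open>An open \<open>V\<close> containing \<open>B\<close> pulls back to a
        competitor in the infimum whose \<open>M\<close>-mass is the \<open>?Q\<close>-mass of
        \<open>V\<close>.\<close>
      have "(INF U\<in>{U. openin T U \<and> A \<subseteq> U}. emeasure M U) \<le> emeasure ?Q V"
        if "B \<subseteq> V" "open V" for V
      proof (rule INF_lower2)
        have "openin T {x \<in> topspace T. e x \<in> V}"
          using e that by (intro openin_continuous_map_preimage) auto
        also have "{x \<in> topspace T. e x \<in> V} = ?pre V"
          by auto
        finally show "?pre V \<in> {U. openin T U \<and> A \<subseteq> U}"
          using that B by auto
      qed (use that in \<open>simp add: Q\<close>)
      then have "(INF U\<in>{U. openin T U \<and> A \<subseteq> U}. emeasure M U) \<le> emeasure ?Q B"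
        by (subst outer_regular[OF _ Q_fin B(1)]) (auto intro!: INF_greatest)
      then show "(INF U\<in>{U. openin T U \<and> A \<subseteq> U}. emeasure M U) \<le> emeasure M A"
        using B by (simp add: Q)
    qed
  next
    fix U
    assume "openin T U"
    then have U: "U \<in> sets M"
      by (simp add: M borel_algebra_openin)
    then obtain B where B: "B \<in> sets borel" "U = ?pre B"
      using pre_ex by blast
    show "emeasure M U = (SUP K\<in>{K. compactin T K \<and> K \<subseteq> U}. emeasure M K)"
    proof (rule antisym)
      show "(SUP K\<in>{K. compactin T K \<and> K \<subseteq> U}. emeasure M K) \<le> emeasure M U"
        using U by (intro SUP_least) (auto intro!: emeasure_mono)
      have "emeasure ?Q K \<le> (SUP K\<in>{K. compactin T K \<and> K \<subseteq> U}. emeasure M K)"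
        if K: "K \<subseteq> B" "compact K" for K
      proof (rule SUP_upper2)
        have "closedin T {x \<in> topspace T. e x \<in> K}"
          using e K by (intro closedin_continuous_map_preimage) (auto simp: compact_imp_closed)
        also have "{x \<in> topspace T. e x \<in> K} = ?pre K"
          by auto
        finally show "?pre K \<in> {K. compactin T K \<and> K \<subseteq> U}"
          using K B T by (auto simp: closedin_compact_space)
      qed (use K in \<open>simp add: Q compact_imp_closed\<close>)
      then have "emeasure ?Q B \<le> (SUP K\<in>{K. compactin T K \<and> K \<subseteq> U}. emeasure M K)"
        by (subst inner_regular[OF _ Q_fin B(1)]) (auto intro!: SUP_least)
      then show "emeasure M U \<le> (SUP K\<in>{K. compactin T K \<and> K \<subseteq> U}. emeasure M K)"
        using B by (simp add: Q)
    qed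
  qed
qed

section \<open>The sequence space and its embedding into \<open>nat => real\<close>\<close>

lemma topspace_seq_topology [simp]: "topspace (seq_topology N) = seq_space N"
  by (simp add: seq_topology_def seq_space_def)

lemma space_seq_algebra [simp]: "space (seq_algebra N) = seq_space N"
  by (simp add: seq_algebra_def seq_space_def space_PiM)

lemma compact_space_seq_topology: "compact_space (seq_topology N)"
  by (simp add: seq_topology_def compact_space_product_topology compact_space_discrete_topology)

lemma continuous_map_seq_topology_component:
  "continuous_map (seq_topology N) (discrete_topology {1..N}) (\<lambda>\<omega>. \<omega> i)"
  unfolding seq_topology_def by (rule continuous_map_product_projection) simp

text \<open>Reading letters as reals places sequences in a complete, second countable metric space,
  as the transfer of regularity requires.\<close>

lemma continuous_map_seq_topology_real:
  "continuous_map (seq_topology N) euclidean (\<lambda>\<omega> i. real (\<omega> i))"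
  unfolding euclidean_product_topology[symmetric] continuous_map_componentwise_UNIV
proof
  fix i
  have "continuous_map (discrete_topology {1..N}) euclidean real"
    by simp
  from continuous_map_compose[OF continuous_map_seq_topology_component this]
  show "continuous_map (seq_topology N) euclidean (\<lambda>\<omega>. real (\<omega> i))"
    by (simp add: comp_def)
qed

lemma inj_on_real_seq: "inj_on (\<lambda>\<omega> i. real (\<omega> i)) A"
  by (auto simp: inj_on_def fun_eq_iff)

text \<open>Every Borel set is a preimage under the embedding into \<open>nat => real\<close>, which
  is measurable for the cylinder algebra because the Borel algebra of this countable product is the
  product of the Borel algebras. Conversely, coordinates are continuous, so cylinders are
  Borel.\<close>

lemma sets_borel_algebra_seq_topology:
  "sets (borel_algebra (seq_topology N)) = sets (seq_algebra N)"
proof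
  let ?e = "\<lambda>\<omega> i. real (\<omega> i)"
  have "?e \<in> measurable (seq_algebra N) (PiM UNIV (\<lambda>_. borel))"
    unfolding seq_algebra_def
  proof (rule measurable_PiM_single')
    fix i :: nat
    have "real \<in> measurable (count_space {1..N}) borel"
      by simp
    from measurable_compose[OF _ this, of "\<lambda>\<omega>. \<omega> i"]
    show "(\<lambda>\<omega>. real (\<omega> i)) \<in> borel_measurable (\<Pi>\<^sub>M i\<in>UNIV. count_space {1..N})"
      by simp
  qed auto
  then have e: "?e \<in> borel_measurable (seq_algebra N)"
    by (simp add: measurable_cong_sets[OF refl sets_PiM_equal_borel])
  show "sets (borel_algebra (seq_topology N)) \<subseteq> sets (seq_algebra N)"
    unfolding borel_algebra_eq_vimage_algebra[OF compact_space_seq_topology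
        continuous_map_seq_topology_real inj_on_real_seq]
    using measurable_sets[OF e] by (auto simp: sets_vimage_algebra2)
next
  have id_measurable: "(\<lambda>\<omega>. \<omega>) \<in> measurable (borel_algebra (seq_topology N)) (seq_algebra N)"
    unfolding seq_algebra_def
  proof (rule measurable_PiM_single')
    fix i :: nat
    show "(\<lambda>\<omega>. \<omega> i) \<in> measurable (borel_algebra (seq_topology N)) (count_space {1..N})"
    proof (rule measurableI)
      fix X
      assume "X \<in> sets (count_space {1..N})"
      then have "openin (seq_topology N) {\<omega> \<in> topspace (seq_topology N). \<omega> i \<in> X}"
        by (intro openin_continuous_map_preimage[OF continuous_map_seq_topology_component]) simp
      also have "{\<omega> \<in> topspace (seq_topology N). \<omega> i \<in> X}
          = (\<lambda>\<omega>. \<omega> i) -` X \<inter> space (borel_algebra (seq_topology N))"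
        by auto
      finally show "(\<lambda>\<omega>. \<omega> i) -` X \<inter> space (borel_algebra (seq_topology N))
          \<in> sets (borel_algebra (seq_topology N))"
        by (rule borel_algebra_openin)
    qed (auto simp: seq_space_def)
  qed (auto simp: seq_space_def)
  show "sets (seq_algebra N) \<subseteq> sets (borel_algebra (seq_topology N))"
  proof
    fix A
    assume A: "A \<in> sets (seq_algebra N)"
    have "A \<inter> seq_space N \<in> sets (borel_algebra (seq_topology N))"
      using measurable_sets[OF id_measurable A] by simp
    moreover have "A \<inter> seq_space N = A"
      using sets.sets_into_space[OF A] by auto
    ultimately show "A \<in> sets (borel_algebra (seq_topology N))"
      by simp
  qed
qed

section \<open>Measures with prescribed cylinder masses\<close>

text \<open>After a word \<open>w\<close> of nonzero mass, letter \<open>k\<close> gets probability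
  \<open>q (Suc n) (w(n := k)) / q n w\<close>; by \<open>q_sum\<close> these add up to 1. Along a
  word their product telescopes, and multiplying by the mass of the empty word restores
  \<open>q n w\<close>.\<close>

lemma ex_measure_cylinder_mass:
  fixes q :: "nat \<Rightarrow> (nat \<Rightarrow> 'a) \<Rightarrow> real"
  assumes S: "finite S" "S \<noteq> {}"
    and q_nonneg: "\<And>n w. w \<in> (\<Pi>\<^sub>E i\<in>{..<n}. S) \<Longrightarrow> 0 \<le> q n w"
    and q_sum: "\<And>n w. w \<in> (\<Pi>\<^sub>E i\<in>{..<n}. S) \<Longrightarrow> (\<Sum>k\<in>S. q (Suc n) (w(n := k))) = q n w"
  shows "\<exists>M. sets M = sets (\<Pi>\<^sub>M i\<in>UNIV. count_space S) \<and>
    (\<forall>n. \<forall>w\<in>(\<Pi>\<^sub>E i\<in>{..<n}. S).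
      emeasure M {\<omega> \<in> (\<Pi>\<^sub>E i\<in>UNIV. S). restrict \<omega> {..<n} = w} = ennreal (q n w))"
proof -
  let ?W = "\<lambda>n::nat. \<Pi>\<^sub>E i\<in>{0..<n}. S"
  have PiM: "(\<Pi>\<^sub>M i\<in>{0..<n::nat}. count_space S) = count_space (?W n)" for n
    using S by (intro count_space_PiM_finite) (auto simp: countable_finite)
  have fin_W: "finite (?W n)" for n
    using S by (intro finite_PiE) auto
  have q0: "0 \<le> q n w" if "w \<in> ?W n" for n w
    using q_nonneg that by (simp add: lessThan_atLeast0)
  have qS: "(\<Sum>k\<in>S. q (Suc n) (w(n := k))) = q n w" if "w \<in> ?W n" for n w
    using q_sum that by (simp add: lessThan_atLeast0)
  have upd: "w(n := k) \<in> ?W (Suc n)" if "w \<in> ?W n" "k \<in> S" for w n k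
    using that by (auto simp: PiE_iff extensional_def)
  \<comment> \<open>Words of mass \<open>0\<close> are never reached; any probability weights on the next letter would do.\<close>
  define p where "p n w k = (if q n w = 0 then 1 / card S else q (Suc n) (w(n := k)) / q n w)"
    for n w k
  have p_nonneg: "0 \<le> p n w k" if "w \<in> ?W n" "k \<in> S" for n w k
    using q0[OF that(1)] q0[OF upd[OF that]] by (simp add: p_def)
  have p_sum: "(\<Sum>k\<in>S. p n w k) = 1" if "w \<in> ?W n" for n w
    using S by (cases "q n w = 0") (simp_all add: p_def sum_divide_distrib[symmetric] qS[OF that])
  \<comment> \<open>If \<open>q n w = 0\<close>, consistency and nonnegativity force all one-letter
    extensions of \<open>w\<close> to have mass 0, so the arbitrary weights chosen there do no
    harm.\<close>
  have p_mult: "q n w * p n w k = q (Suc n) (w(n := k))" if "w \<in> ?W n" "k \<in> S" for n w k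
  proof (cases "q n w = 0")
    case True
    then have "\<forall>k\<in>S. q (Suc n) (w(n := k)) = 0"
      using qS[OF that(1)] q0[OF upd[OF that(1)]] S by (simp add: sum_nonneg_eq_0_iff)
    with True that show ?thesis
      by simp
  qed (simp add: p_def)
  define K where "K n w = point_measure S (\<lambda>k. ennreal (p n w k))" for n w
  have prob_K: "prob_space (K n w)" if "w \<in> ?W n" for n w
    using that S p_nonneg[OF that] p_sum[OF that]
    by (intro prob_spaceI) (simp add: K_def space_point_measure emeasure_point_measure_finite)
  interpret Ionescu_Tulcea K "\<lambda>_. count_space S"
  proof (rule Ionescu_Tulcea.intro)
    \<comment> \<open>There are finitely many words of length \<open>n\<close>, so their product
      algebra is discrete and any family of probability kernels on it is measurable.\<close>
    show "K n \<in> measurable (\<Pi>\<^sub>M i\<in>{0..<n}. count_space S) (subprob_algebra (count_space S))" for n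
      unfolding PiM
      by (auto simp: space_subprob_algebra prob_K prob_space_imp_subprob_space)
        (auto simp: K_def sets_point_measure)
    show "prob_space (K n w)" if "w \<in> space (\<Pi>\<^sub>M i\<in>{0..<n}. count_space S)" for n w
      using that by (simp add: PiM prob_K)
  qed
  \<comment> \<open>\<open>?u\<close> is the empty word, so \<open>C 0 n ?u\<close> is the law of
    the first \<open>n\<close> letters.\<close>
  let ?u = "\<lambda>_. undefined"
  \<comment> \<open>Stated as a product, the claim also holds when the total mass
    \<open>q 0 ?u\<close> is 0.\<close>
  have C: "ennreal (q 0 ?u) * emeasure (C 0 n ?u) {w} = ennreal (q n w)" if "w \<in> ?W n" for n w
    using that
  proof (induction n arbitrary: w)
    case 0
    then show ?case
      by (simp add: PiM_empty)
  next
    case (Suc n)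
    define v where "v = restrict w {0..<n}"
    have v: "v \<in> ?W n" and k: "w n \<in> S" and w: "w = v(n := w n)"
      using Suc.prems by (auto simp: v_def PiE_iff extensional_def fun_eq_iff)
    have sets_C': "sets (C 0 n ?u) = sets (count_space (?W n))"
      using sets_C[of ?u 0 n] by (simp add: PiM)
    have sp: "space (C 0 n ?u) = ?W n"
      using sets_eq_imp_space_eq[OF sets_C'] by simp
    \<comment> \<open>\<open>eP n v'\<close> appends to \<open>v'\<close> a random letter with law
      \<open>K n v'\<close>; it can produce \<open>w\<close> only from the prefix \<open>v\<close>,
      by choosing the letter \<open>w n\<close>.\<close>
    have eP_w: "emeasure (eP n v') {w} = ennreal (p n v (w n)) * indicator {v} v'"
      if v': "v' \<in> ?W n" for v'
    proof -
      have "fun_upd v' n -` {w} \<inter> S = (if v' = v then {w n} else {})"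
      proof -
        have "v' = v" if "v'(n := x) = w" for x
          using that v' unfolding v_def by (force simp: PiE_iff extensional_def)
        moreover have "x = w n" if "v'(n := x) = w" for x
          using that by auto
        ultimately show ?thesis
          using w k by auto
      qed
      then show ?thesis
        using v' Suc.prems k S
        by (subst emeasure_eP) (auto simp: PiM K_def emeasure_point_measure_finite)
    qed
    have "emeasure (C 0 (Suc n) ?u) {w} = (\<integral>\<^sup>+v'. emeasure (eP n v') {w} \<partial>C 0 n ?u)"
      using measurable_eP[of n] v Suc.prems sp
      by (simp, intro emeasure_bind[where N = "\<Pi>\<^sub>M i\<in>{0..<Suc n}. count_space S"])
        (auto simp: measurable_cong_sets[OF sets_C' refl] PiM)
    also have "\<dots> = (\<integral>\<^sup>+v'. ennreal (p n v (w n)) * indicator {v} v' \<partial>C 0 n ?u)"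
      by (intro nn_integral_cong) (simp add: sp eP_w)
    also have "\<dots> = ennreal (p n v (w n)) * emeasure (C 0 n ?u) {v}"
      using v by (intro nn_integral_cmult_indicator) (simp add: sets_C')
    finally have "ennreal (q 0 ?u) * emeasure (C 0 (Suc n) ?u) {w}
        = ennreal (q n v) * ennreal (p n v (w n))"
      by (simp only: Suc.IH[OF v, symmetric] mult_ac)
    also have "\<dots> = ennreal (q (Suc n) w)"
      using p_mult[OF v k] q0[OF v] p_nonneg[OF v k] w by (simp add: ennreal_mult[symmetric])
    finally show ?case .
  qed
  \<comment> \<open>The limit is a probability measure; scaling undoes the normalisation, and gives
    the zero measure if \<open>q 0 ?u = 0\<close>.\<close>
  let ?M = "scale_measure (ennreal (q 0 ?u)) PF.lim"
  have "emeasure ?M {\<omega> \<in> (\<Pi>\<^sub>E i\<in>UNIV. S). restrict \<omega> {..<n} = w} = ennreal (q n w)"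
    if "w \<in> (\<Pi>\<^sub>E i\<in>{..<n}. S)" for n w
  proof -
    have w: "w \<in> ?W n"
      using that by (simp add: lessThan_atLeast0)
    then have w_sets: "{w} \<in> sets (\<Pi>\<^sub>M i\<in>{0..<n}. count_space S)"
      by (simp add: PiM)
    \<comment> \<open>As an embedded singleton, the cylinder has its limit mass fixed by the
      marginal \<open>CI {0..<n}\<close>, which is in turn computed from
      \<open>C 0 n ?u\<close>.\<close>
    have "{\<omega> \<in> (\<Pi>\<^sub>E i\<in>UNIV. S). restrict \<omega> {..<n} = w}
        = prod_emb UNIV (\<lambda>_. count_space S) {0..<n} {w}"
      by (auto simp: prod_emb_def lessThan_atLeast0)
    then have "emeasure PF.lim {\<omega> \<in> (\<Pi>\<^sub>E i\<in>UNIV. S). restrict \<omega> {..<n} = w}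
        = emeasure (CI {0..<n}) {w}"
      using lim[OF _ w_sets] by simp
    also have "\<dots> = emeasure (C 0 n ?u) (prod_emb {0..<n} (\<lambda>_. count_space S) {0..<n} {w})"
      by (rule emeasure_CI[OF _ w_sets]) simp
    also have "prod_emb {0..<n} (\<lambda>_. count_space S) {0..<n} {w} = {w}"
      using w by (intro prod_emb_id) simp
    finally show ?thesis
      using C[OF w] by (simp only: emeasure_scale_measure)
  qed
  moreover have "sets ?M = sets (\<Pi>\<^sub>M i\<in>UNIV. count_space S)"
    by simp
  ultimately show ?thesis
    by blast
qed

section \<open>Weights of words and integrals of cylinder functions\<close>

lemma branch_word_cong:
  "(\<And>i. i < n \<Longrightarrow> v i = w i) \<Longrightarrow> branch_word \<tau> v n x = branch_word \<tau> w n x"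
  by (induction n) auto

text \<open>Applied at \<open>\<tau> k y\<close>, where \<open>r\<close> leads back to
  \<open>y\<close>, this shows that appending a letter to a word multiplies the cocycle by
  \<open>W\<close> at the new end point.\<close>

lemma cocycle_Suc: "cocycle W r (Suc n) x = W x * cocycle W r n (r x)"
  unfolding cocycle_def by (simp add: prod.lessThan_Suc_shift funpow_swap1 del: prod.lessThan_Suc)

text \<open>The cylinders of length \<open>n\<close> form a finite partition on whose pieces
  \<open>f\<close> is constant, so \<open>f\<close> is a finite combination of cylinder indicators,
  each integrable because \<open>M\<close> is finite.\<close>

lemma integral_depends_on_first:
  fixes f :: "(nat \<Rightarrow> nat) \<Rightarrow> 'b::{banach, second_countable_topology}"
  assumes M: "finite_measure M" "sets M = sets (seq_algebra N)"
    and dep: "depends_on_first N n f g"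
  shows "(\<integral>\<omega>. f \<omega> \<partial>M) =
    (\<Sum>w\<in>(\<Pi>\<^sub>E i\<in>{..<n}. {1..N}). measure M {\<omega> \<in> seq_space N. restrict \<omega> {..<n} = w} *\<^sub>R g w)"
proof -
  interpret finite_measure M by fact
  let ?W = "\<Pi>\<^sub>E i\<in>{..<n}. {1..N}"
  let ?cyl = "\<lambda>w. {\<omega> \<in> seq_space N. restrict \<omega> {..<n} = w}"
  have fin: "finite ?W"
    by (intro finite_PiE) auto
  have space: "space M = seq_space N"
    using sets_eq_imp_space_eq[OF M(2)] by simp
  have cyl [measurable]: "?cyl w \<in> sets M" if "w \<in> ?W" for w
  \<comment> \<open>A word is a box of singletons, so its cylinder is a generator of the product
    algebra.\<close>
  proof -
    have "prod_emb UNIV (\<lambda>_. count_space {1..N}) {..<n} (\<Pi>\<^sub>E i\<in>{..<n}. {w i})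
        \<in> sets (\<Pi>\<^sub>M i\<in>UNIV. count_space {1..N})"
      using that by (intro sets_PiM_I) (auto simp: PiE_iff)
    moreover have "(\<Pi>\<^sub>E i\<in>{..<n}. {w i}) = {w}"
      using that by (simp add: PiE_singleton PiE_iff)
    moreover have "?cyl w = prod_emb UNIV (\<lambda>_. count_space {1..N}) {..<n} {w}"
      by (auto simp: prod_emb_def seq_space_def)
    ultimately show ?thesis
      by (simp only: M(2) seq_algebra_def)
  qed
  have "f \<omega> = (\<Sum>w\<in>?W. indicator (?cyl w) \<omega> *\<^sub>R g w)" if "\<omega> \<in> space M" for \<omega>
  proof -
    have "restrict \<omega> {..<n} \<in> ?W"
      using that by (auto simp: space seq_space_def)
    moreover have "indicator (?cyl w) \<omega> *\<^sub>R g w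
        = (if restrict \<omega> {..<n} = w then g w else 0)" for w
      using that by (simp add: indicator_def space)
    ultimately show ?thesis
      using dep that fin by (simp add: depends_on_first_def space)
  qed
  then have "(\<integral>\<omega>. f \<omega> \<partial>M) = (\<integral>\<omega>. (\<Sum>w\<in>?W. indicator (?cyl w) \<omega> *\<^sub>R g w) \<partial>M)"
    by (intro Bochner_Integration.integral_cong) auto
  also have "\<dots> = (\<Sum>w\<in>?W. \<integral>\<omega>. indicator (?cyl w) \<omega> *\<^sub>R g w \<partial>M)"
    using cyl by (intro Bochner_Integration.integral_sum integrable_scaleR_left)
      (auto simp: integrable_indicator_iff less_top[symmetric])
  also have "\<dots> = (\<Sum>w\<in>?W. measure M (?cyl w) *\<^sub>R g w)"
    using cyl by (intro sum.cong refl) (simp add: less_top[symmetric])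
  finally show ?thesis .
qed

section \<open>Construction of the measure attached to each point\<close>

theorem proposition4p3p9:
  fixes r :: "'a::metric_space \<Rightarrow> 'a"
    and N :: nat
    and \<tau> :: "nat \<Rightarrow> 'a \<Rightarrow> 'a"
    and W h :: "'a \<Rightarrow> real"
  assumes branch: "\<And>k x. k \<in> {1..N} \<Longrightarrow> r (\<tau> k x) = x"
    and disjoint: "disjoint_family_on (\<lambda>k. range (\<tau> k)) {1..N}"
    and cover: "(\<Union>k\<in>{1..N}. range (\<tau> k)) = UNIV"
    and W_nonneg: "\<And>x. 0 \<le> W x"
    and h_nonneg: "\<And>x. 0 \<le> h x"
    and harmonic: "\<And>x. (\<Sum>k=1..N. W (\<tau> k x) * h (\<tau> k x)) = h x"
  shows "\<forall>x. \<exists>P :: (nat \<Rightarrow> nat) measure.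
    radon_measure (seq_topology N) P \<and>
    sets P = sets (seq_algebra N) \<and>
    (\<forall>n\<ge>1. \<forall>f :: (nat \<Rightarrow> nat) \<Rightarrow> complex. \<forall>g.
       f \<in> borel_measurable (seq_algebra N) \<and>
       bounded (f ` seq_space N) \<and>
       depends_on_first N n f g \<longrightarrow>
       (\<integral>\<omega>. f \<omega> \<partial>P) =
         (\<Sum>w\<in>(\<Pi>\<^sub>E i\<in>{..<n}. {1..N}).
            of_real (cocycle W r n (branch_word \<tau> w n x) * h (branch_word \<tau> w n x)) * g w))"
proof
  fix x
  define q where "q n w = cocycle W r n (branch_word \<tau> w n x) * h (branch_word \<tau> w n x)" for n w
  have q_nonneg: "0 \<le> q n w" for n w
    by (simp add: q_def cocycle_def W_nonneg h_nonneg prod_nonneg)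
  \<comment> \<open>Changing letter \<open>n\<close> leaves the point \<open>?y\<close> reached
    after \<open>n\<close> letters unchanged. The old cocycle at \<open>?y\<close> factors out, and
    what remains is the harmonicity sum at \<open>?y\<close>.\<close>
  have q_sum: "(\<Sum>k\<in>{1..N}. q (Suc n) (w(n := k))) = q n w" for n w
  proof -
    let ?y = "branch_word \<tau> w n x"
    have "branch_word \<tau> (w(n := k)) n x = ?y" for k
      by (rule branch_word_cong) simp
    then have "(\<Sum>k\<in>{1..N}. q (Suc n) (w(n := k)))
        = (\<Sum>k\<in>{1..N}. cocycle W r n ?y * (W (\<tau> k ?y) * h (\<tau> k ?y)))"
      by (intro sum.cong refl) (simp add: q_def cocycle_Suc branch)
    also have "\<dots> = q n w"
      by (simp only: sum_distrib_left[symmetric] harmonic q_def)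
    finally show ?thesis .
  qed
  \<comment> \<open>An empty alphabet would make the union of the ranges empty, whereas the type of
    \<open>x\<close> is inhabited.\<close>
  have N: "{1..N} \<noteq> {}"
    using cover by auto
  obtain P where sets_P: "sets P = sets (seq_algebra N)"
    and P: "\<And>n w. w \<in> (\<Pi>\<^sub>E i\<in>{..<n}. {1..N}) \<Longrightarrow>
      emeasure P {\<omega> \<in> seq_space N. restrict \<omega> {..<n} = w} = ennreal (q n w)"
    using ex_measure_cylinder_mass[OF finite_atLeastAtMost N q_nonneg q_sum]
    unfolding seq_algebra_def seq_space_def by auto
  have space_P: "space P = seq_space N"
    using sets_eq_imp_space_eq[OF sets_P] by simp
  have fin_P: "finite_measure P"
  proof
    \<comment> \<open>The cylinder of the empty word is the whole space, so the total mass is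
      \<open>q 0\<close>, that is, \<open>h x\<close>.\<close>
    have "restrict \<omega> {..<0} = (\<lambda>_. undefined)" for \<omega> :: "nat \<Rightarrow> nat"
      by auto
    then show "emeasure P (space P) \<noteq> \<infinity>"
      using P[of "\<lambda>_. undefined" 0] by (simp add: space_P)
  qed
  have radon: "radon_measure (seq_topology N) P"
    using radon_measure_compact_space[OF compact_space_seq_topology
        continuous_map_seq_topology_real inj_on_real_seq fin_P]
    by (simp add: sets_P sets_borel_algebra_seq_topology)
  \<comment> \<open>Nonnegativity of \<open>q\<close> makes the passage from \<open>ennreal\<close>
    masses to real ones exact.\<close>
  have measure_P: "measure P {\<omega> \<in> seq_space N. restrict \<omega> {..<n} = w} = q n w"
    if "w \<in> (\<Pi>\<^sub>E i\<in>{..<n}. {1..N})" for n w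
    unfolding measure_def P[OF that] using q_nonneg by simp
  have "(\<integral>\<omega>. f \<omega> \<partial>P) = (\<Sum>w\<in>(\<Pi>\<^sub>E i\<in>{..<n}. {1..N}). of_real (q n w) * g w)"
    if "depends_on_first N n f g" for n and f :: "(nat \<Rightarrow> nat) \<Rightarrow> complex" and g
    unfolding integral_depends_on_first[OF fin_P sets_P that]
    by (intro sum.cong refl) (simp only: measure_P scaleR_conv_of_real)
  with radon sets_P show "\<exists>P :: (nat \<Rightarrow> nat) measure.
    radon_measure (seq_topology N) P \<and>
    sets P = sets (seq_algebra N) \<and>
    (\<forall>n\<ge>1. \<forall>f :: (nat \<Rightarrow> nat) \<Rightarrow> complex. \<forall>g.
       f \<in> borel_measurable (seq_algebra N) \<and>
       bounded (f ` seq_space N) \<and>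
       depends_on_first N n f g \<longrightarrow>
       (\<integral>\<omega>. f \<omega> \<partial>P) =
         (\<Sum>w\<in>(\<Pi>\<^sub>E i\<in>{..<n}. {1..N}).
            of_real (cocycle W r n (branch_word \<tau> w n x) * h (branch_word \<tau> w n x)) * g w))"
    unfolding q_def by blast
qed

end
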